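(* Let $k\geq 2$, let $f_1,\dots,f_k:\mathbb{R}^n\to\mathbb{R}$ be known signals (in particular, their Fourier transforms $\mathcal{F}(f_j)$ are known), and let $$F(x)=\sum_{j=1}^k\sum_{q=1}^{q_j}a_{jq}\,f_j(x-x_{jq}),\qquad a_{jq}\in\mathbb{R},\ x_{jq}=(x^1_{jq},\dots,x^n_{jq})\in\mathbb{R}^n .$$ For $j=1,\dots,k$ let $Z_j=\{s\in\mathbb{R}^n:\ \mathcal{F}(f_j)(s)=0\}$, and for $r=1,\dots,k$ let $W_r=\bigl(\bigcap_{j\neq r}Z_j\bigr)\setminus Z_r$. Let for each $r=1,\dots,k$ the sampling set $S_r$ satisfy $S_r=\{s_{r1},\dots,s_{rm_r}\}\subset W_r$. Then for each $r$ the reconstruction system on the sample set $S_r$, $$\sum_{j=1}^k\sum_{q=1}^{q_j}a_{jq}\,\mathcal{F}(f_j)(s_{r\ell})\,y_{jq}^{s_{r\ell}}=\mathcal{F}(F)(s_{r\ell}),\qquad \ell=1,\dots,m_r,$$ takes the form $$\sum_{q=1}^{q_r}a_{rq}\,y_{rq}^{s_{r\ell}}=c_{r\ell}(F),\qquad \ell=1,\dots,m_r,$$ where $c_{r\ell}(F)=\mathcal{F}(F)(s_{r\ell})/\mathcal{F}(f_r)(s_{r\ell})$.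
   Context: The Fourier transform is $\mathcal{F}(g)(s)=\int_{\mathbb{R}^n}e^{-2\pi i\, s\cdot x}g(x)\,dx$ for $s\in\mathbb{R}^n$. For a shift $x_{jq}=(x_{jq}^1,\dots,x_{jq}^n)$ we write $y_{jq}=(e^{-2\pi i x^1_{jq}},\dots,e^{-2\pi i x^n_{jq}})$, and for $s\in\mathbb{R}^n$ the multi-index power $y_{jq}^{s}$ denotes $e^{-2\pi i\, s\cdot x_{jq}}$. The reconstruction system is obtained by equating the expression of the Fourier samples of $F$ in terms of the unknown parameters $a_{jq},x_{jq}$ to the measured values $\mathcal{F}(F)(s)$, $s\in S_r$. *)

theory Defs
  imports "HOL-Analysis.Analysis"
begin

definition fourier :: "(real ^ 'n \<Rightarrow> real) \<Rightarrow> real ^ 'n \<Rightarrow> complex" where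
  "fourier g s =
    (LINT x|lebesgue. exp (- 2 * complex_of_real pi * \<i> * complex_of_real (s \<bullet> x)) * complex_of_real (g x))"

definition fourier_zeros :: "(real ^ 'n \<Rightarrow> real) \<Rightarrow> (real ^ 'n) set" where
  "fourier_zeros g = {s. fourier g s = 0}"

definition decoupling_set :: "nat \<Rightarrow> (nat \<Rightarrow> real ^ 'n \<Rightarrow> real) \<Rightarrow> nat \<Rightarrow> (real ^ 'n) set" where
  "decoupling_set k f r = (\<Inter>j\<in>{1..k} - {r}. fourier_zeros (f j)) - fourier_zeros (f r)"

text \<open>
  The power \<open>y\<^sup>s\<close>, where \<open>y\<close> has the components \<open>exp (- 2 \<pi> \<i> x\<^sub>i)\<close>. For a non-integral
  exponent it is not determined by \<open>y\<close> alone, so it is a function of the shift \<open>x\<close>.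
\<close>

definition shift_power :: "real ^ 'n \<Rightarrow> real ^ 'n \<Rightarrow> complex" where
  "shift_power x s = exp (- 2 * complex_of_real pi * \<i> * complex_of_real (s \<bullet> x))"

text \<open>
  In the next two definitions \<open>b\<close> and \<open>z\<close> are values for the unknown amplitudes and shifts;
  \<open>F\<close> enters only through its measured Fourier sample at \<open>s\<close>.
\<close>

definition reconstruction_eq ::
  "nat \<Rightarrow> (nat \<Rightarrow> nat) \<Rightarrow> (nat \<Rightarrow> real ^ 'n \<Rightarrow> real) \<Rightarrow> (real ^ 'n \<Rightarrow> real) \<Rightarrow>
    (nat \<Rightarrow> nat \<Rightarrow> real) \<Rightarrow> (nat \<Rightarrow> nat \<Rightarrow> real ^ 'n) \<Rightarrow> real ^ 'n \<Rightarrow> bool" where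
  "reconstruction_eq k q f F b z s \<longleftrightarrow>
    (\<Sum>j=1..k. \<Sum>p=1..q j. complex_of_real (b j p) * fourier (f j) s * shift_power (z j p) s)
      = fourier F s"

definition decoupled_eq ::
  "(nat \<Rightarrow> nat) \<Rightarrow> (nat \<Rightarrow> real ^ 'n \<Rightarrow> real) \<Rightarrow> (real ^ 'n \<Rightarrow> real) \<Rightarrow> nat \<Rightarrow>
    (nat \<Rightarrow> nat \<Rightarrow> real) \<Rightarrow> (nat \<Rightarrow> nat \<Rightarrow> real ^ 'n) \<Rightarrow> real ^ 'n \<Rightarrow> bool" where
  "decoupled_eq q f F r b z s \<longleftrightarrow>
    (\<Sum>p=1..q r. complex_of_real (b r p) * shift_power (z r p) s) = fourier F s / fourier (f r) s"

end

theory Submission imports Defs begin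

text \<open>At a point \<open>s\<close> of \<open>decoupling_set k f r\<close> every transform
  \<open>fourier (f j) s\<close> with j \<noteq> r vanishes, so the double sum collapses to the
  block of \<open>f r\<close>. That block has the common factor \<open>fourier (f r) s\<close>,
  which is nonzero there and can be divided out. This is
  \<open>reconstruction_eq_iff_decoupled_eq\<close>, an algebraic fact about arbitrary candidate
  parameters. That the actual amplitudes and shifts of \<open>F\<close> solve the system is an
  analytic fact, \<open>reconstruction_eq_true_parameters\<close>: the Fourier transform is linear
  on integrable signals, and by \<open>fourier_translate\<close> it turns a shift by
  \<open>x\<close> into multiplication by \<open>shift_power x s\<close>. The latter rests on the
  translation invariance of Lebesgue measure.\<close>

lemma distr_lebesgue_translation:
  fixes c :: "'a::euclidean_space"
  shows "distr lebesgue lebesgue (\<lambda>t. c + t) = lebesgue"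
    and measurable_lebesgue_translation: "(\<lambda>t. c + t) \<in> lebesgue \<rightarrow>\<^sub>M lebesgue"
proof -
  \<comment> \<open>A translation is the affine map with scaling factor 1 along each basis vector,
    so its Jacobian factor is 1.\<close>
  have affine: "(\<lambda>t. c + (\<Sum>j\<in>Basis. (1 * (t \<bullet> j)) *\<^sub>R j)) = (\<lambda>t. c + t)"
    by (simp add: euclidean_representation)
  show "(\<lambda>t. c + t) \<in> lebesgue \<rightarrow>\<^sub>M lebesgue"
    using lebesgue_affine_measurable[of "\<lambda>_. 1" c] unfolding affine by simp
  show "distr lebesgue lebesgue (\<lambda>t. c + t) = lebesgue"
    using lebesgue_affine_euclidean[of "\<lambda>_. 1" c] unfolding affine
    by (simp add: density_1)
qed

lemma
  fixes g :: "'a::euclidean_space \<Rightarrow> 'b::{banach, second_countable_topology}"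
  assumes "g \<in> borel_measurable lebesgue"
  shows integrable_lebesgue_translation_iff:
      "integrable lebesgue (\<lambda>t. g (c + t)) \<longleftrightarrow> integrable lebesgue g"
    and integral_lebesgue_translation:
      "(LINT t|lebesgue. g (c + t)) = (LINT t|lebesgue. g t)"
  using integrable_distr_eq[OF measurable_lebesgue_translation assms, of c]
    integral_distr[OF measurable_lebesgue_translation assms, of c]
  by (simp_all add: distr_lebesgue_translation)

lemma shift_power_add: "shift_power (x + y) s = shift_power x s * shift_power y s"
  by (simp add: shift_power_def inner_add_right algebra_simps flip: exp_add)

lemma norm_shift_power [simp]: "norm (shift_power x s) = 1"
  by (simp add: shift_power_def)

lemma fourier_eq_integral_shift_power:
  "fourier g s = (LINT t|lebesgue. shift_power t s * complex_of_real (g t))"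
  by (simp add: fourier_def shift_power_def)

text \<open>The character is continuous and of modulus one, so the product is measurable and
  dominated by \<open>g\<close> itself.\<close>

lemma integrable_shift_power_mult:
  assumes "integrable lebesgue g"
  shows "integrable lebesgue (\<lambda>t. shift_power t s * complex_of_real (g t))"
proof (rule Bochner_Integration.integrable_bound[OF assms])
  have "(\<lambda>t. shift_power t s) \<in> borel_measurable borel"
    unfolding shift_power_def by (intro borel_measurable_continuous_onI continuous_intros)
  then have [measurable]: "(\<lambda>t. shift_power t s) \<in> borel_measurable lebesgue"
    by (simp add: measurable_completion)
  have [measurable]: "g \<in> borel_measurable lebesgue"
    using assms by (rule borel_measurable_integrable)
  show "(\<lambda>t. shift_power t s * complex_of_real (g t)) \<in> borel_measurable lebesgue"
    by measurable
qed (simp add: norm_mult)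

lemma integrable_translate:
  fixes g :: "'a::euclidean_space \<Rightarrow> 'b::{banach, second_countable_topology}"
  assumes "integrable lebesgue g"
  shows "integrable lebesgue (\<lambda>t. g (t - x))"
  using integrable_lebesgue_translation_iff[OF borel_measurable_integrable[OF assms], of "- x"] assms
  by simp

lemma fourier_translate:
  assumes "integrable lebesgue g"
  shows "fourier (\<lambda>t. g (t - x)) s = fourier g s * shift_power x s"
proof -
  let ?h = "\<lambda>t. shift_power t s * complex_of_real (g t)"
  \<comment> \<open>Splitting t = x + (t - x) in the character leaves a constant factor times a
    translate of \<open>?h\<close>.\<close>
  have "(\<lambda>t. shift_power t s * complex_of_real (g (t - x))) =
      (\<lambda>t. shift_power x s * ?h (- x + t))"
    by (simp add: fun_eq_iff flip: shift_power_add mult.assoc)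
  then have "fourier (\<lambda>t. g (t - x)) s = shift_power x s * (LINT t|lebesgue. ?h (- x + t))"
    unfolding fourier_eq_integral_shift_power by (simp only: integral_mult_right_zero)
  also have "(LINT t|lebesgue. ?h (- x + t)) = fourier g s"
    using integral_lebesgue_translation[OF borel_measurable_integrable
        [OF integrable_shift_power_mult[OF assms]], of "- x"]
    by (simp add: fourier_eq_integral_shift_power)
  finally show ?thesis
    by simp
qed

lemma fourier_cmult: "fourier (\<lambda>t. c * g t) s = complex_of_real c * fourier g s"
  by (simp add: fourier_eq_integral_shift_power mult.left_commute)

text \<open>Integrability matters here: the integral of a non-integrable function is 0 by
  convention, which would break additivity.\<close>

lemma fourier_sum:
  assumes "\<And>i. i \<in> I \<Longrightarrow> integrable lebesgue (g i)"
  shows "fourier (\<lambda>t. \<Sum>i\<in>I. g i t) s = (\<Sum>i\<in>I. fourier (g i) s)"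
  using assms
  by (simp add: fourier_eq_integral_shift_power sum_distrib_left integrable_shift_power_mult)

lemma reconstruction_eq_true_parameters:
  assumes "\<And>j. j \<in> {1..k} \<Longrightarrow> integrable lebesgue (f j)"
  shows "reconstruction_eq k q f (\<lambda>t. \<Sum>j=1..k. \<Sum>p=1..q j. a j p * f j (t - x j p)) a x s"
proof -
  have integrable: "integrable lebesgue (\<lambda>t. a j p * f j (t - x j p))" if "j \<in> {1..k}" for j p
    using assms[OF that] by (intro integrable_mult_right integrable_translate)
  have "fourier (\<lambda>t. \<Sum>j=1..k. \<Sum>p=1..q j. a j p * f j (t - x j p)) s =
      (\<Sum>j=1..k. fourier (\<lambda>t. \<Sum>p=1..q j. a j p * f j (t - x j p)) s)"
    by (intro fourier_sum Bochner_Integration.integrable_sum integrable)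
  also have "\<dots> = (\<Sum>j=1..k. \<Sum>p=1..q j. fourier (\<lambda>t. a j p * f j (t - x j p)) s)"
    by (intro sum.cong refl fourier_sum integrable)
  also have "\<dots> = (\<Sum>j=1..k. \<Sum>p=1..q j.
      complex_of_real (a j p) * fourier (f j) s * shift_power (x j p) s)"
    by (intro sum.cong refl) (simp add: fourier_cmult fourier_translate assms)
  finally show ?thesis
    by (simp add: reconstruction_eq_def)
qed

lemma reconstruction_eq_iff_decoupled_eq:
  assumes r: "r \<in> {1..k}" and s: "s \<in> decoupling_set k f r"
  shows "reconstruction_eq k q f F b z s \<longleftrightarrow> decoupled_eq q f F r b z s"
proof -
  let ?u = "\<lambda>j. \<Sum>p=1..q j. complex_of_real (b j p) * fourier (f j) s * shift_power (z j p) s"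
  have "?u j = 0" if "j \<in> {1..k} - {r}" for j
    using s that by (simp add: decoupling_set_def fourier_zeros_def)
  then have "(\<Sum>j=1..k. ?u j) = ?u r"
    using r by (simp add: sum.remove)
  also have "\<dots> = (\<Sum>p=1..q r. complex_of_real (b r p) * shift_power (z r p) s) * fourier (f r) s"
    by (simp add: sum_distrib_left ac_simps)
  \<comment> \<open>The set also excludes the zeros of \<open>fourier (f r)\<close>, so the division
    by it is reversible and gives an equivalence.\<close>
  finally show ?thesis
    using s by (simp add: reconstruction_eq_def decoupled_eq_def decoupling_set_def
        fourier_zeros_def eq_divide_eq)
qed

text \<open>Since the parameters are unknown, the two systems are compared for all candidates
  \<open>b\<close> and \<open>z\<close>, which says that they have the same solutions. The second
  conjunct adds that, for integrable signals, the actual parameters \<open>a\<close> and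
  \<open>x\<close> are among these solutions.\<close>

theorem mainTheorem1:
  fixes k :: nat
    and f :: "nat \<Rightarrow> real ^ 'n \<Rightarrow> real"
    and q :: "nat \<Rightarrow> nat"
    and a :: "nat \<Rightarrow> nat \<Rightarrow> real"
    and x :: "nat \<Rightarrow> nat \<Rightarrow> real ^ 'n"
    and F :: "real ^ 'n \<Rightarrow> real"
    and m :: "nat \<Rightarrow> nat"
    and s :: "nat \<Rightarrow> nat \<Rightarrow> real ^ 'n"
    and S :: "nat \<Rightarrow> (real ^ 'n) set"
  assumes "k \<ge> 2"
    and "F = (\<lambda>t. \<Sum>j=1..k. \<Sum>p=1..q j. a j p * f j (t - x j p))"
    and "\<And>r. r \<in> {1..k} \<Longrightarrow> S r = s r ` {1..m r}"
    and "\<And>r. r \<in> {1..k} \<Longrightarrow> S r \<subseteq> decoupling_set k f r"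
  shows "\<forall>r\<in>{1..k}.
      (\<forall>b z. \<forall>l\<in>{1..m r}.
         reconstruction_eq k q f F b z (s r l) \<longleftrightarrow> decoupled_eq q f F r b z (s r l)) \<and>
      ((\<forall>j\<in>{1..k}. integrable lebesgue (f j)) \<longrightarrow>
        (\<forall>l\<in>{1..m r}.
           reconstruction_eq k q f F a x (s r l) \<and> decoupled_eq q f F r a x (s r l)))"
proof (intro ballI conjI allI impI)
  fix r l
  assume r: "r \<in> {1..k}" and l: "l \<in> {1..m r}"
  have "s r l \<in> decoupling_set k f r"
    using assms(3,4)[OF r] l by auto
  note iff = reconstruction_eq_iff_decoupled_eq[OF r this]
  show "reconstruction_eq k q f F b z (s r l) \<longleftrightarrow> decoupled_eq q f F r b z (s r l)" for b z
    by (rule iff)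
  assume "\<forall>j\<in>{1..k}. integrable lebesgue (f j)"
  then show "reconstruction_eq k q f F a x (s r l)"
    unfolding assms(2) by (intro reconstruction_eq_true_parameters) blast
  then show "decoupled_eq q f F r a x (s r l)"
    by (simp add: iff)
qed

end
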